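(* Let $L$ be an infinite-dimensional Lie subalgebra of $\mathbb{W}_1$. Then there exist $f,g \in \Bbbk[t]$ with $f \notin \Bbbk$, $g \neq 0$, and $f'g \in \Bbbk[f]$ such that $$L(f,g) \subseteq L \subseteq L(f).$$ In particular, $L$ has finite codimension in $L(f)$. Moreover, $f$ and $g$ are unique under the normalisations: $f$ is monic with $f(0)=0$, and $g$ is monic of minimal degree such that $f'g\in\Bbbk[f]$ and $L(f,g) \subseteq L$. Precisely: if $\widetilde f, \widetilde g \in \Bbbk[t]$ (with $f'\widetilde g$, resp. $\widetilde f'\widetilde g$, in the appropriate $\Bbbk[\cdot]$) satisfy $L(\widetilde f,\widetilde g) \subseteq L \subseteq L(\widetilde f)$, then $\widetilde f = \alpha f + \beta$ for some $\alpha,\beta\in\Bbbk$ with $\alpha \neq 0$, and $\widetilde g = p(f)g$ for some $p \in \Bbbk[t]$. In particular $L(\widetilde f) = L(f)$ and $L(\widetilde f, \widetilde g) \subseteq L(f,g)$.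
   Context: $\Bbbk$ is a field of characteristic zero. $\mathbb{W}_1 = \mathrm{Der}(\Bbbk[t]) = \Bbbk[t]\partial$ with $\partial = d/dt$ and bracket $[f\partial, g\partial] = (fg'-f'g)\partial$. For $f,g \in \Bbbk[t]\setminus\{0\}$ with $f'g \in \Bbbk[f]$, write $L(f,g) = \Bbbk[f]\,g\partial$ (a Lie subalgebra of $\mathbb{W}_1$). For nonconstant $f$, let $g_f$ be the unique monic polynomial of minimal degree with $f'g_f \in \Bbbk[f]$, and put $L(f) = L(f,g_f)$. *)

theory Defs
  imports "HOL-Computational_Algebra.Polynomial"
begin

text \<open>The Witt algebra W_1 = k[t] d/dt: the element h d/dt is represented by the
polynomial h. The bracket [f d, g d] = (f g' - f' g) d.\<close>

definition W1_bracket :: "'a::field_char_0 poly \<Rightarrow> 'a poly \<Rightarrow> 'a poly" where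
  "W1_bracket f g = f * pderiv g - pderiv f * g"

definition W1_lie_subalgebra :: "'a::field_char_0 poly set \<Rightarrow> bool" where
  "W1_lie_subalgebra L \<longleftrightarrow> module.subspace smult L \<and>
     (\<forall>a\<in>L. \<forall>b\<in>L. W1_bracket a b \<in> L)"

definition fin_dim :: "'a::field_char_0 poly set \<Rightarrow> bool" where
  "fin_dim L \<longleftrightarrow> (\<exists>B. finite B \<and> B \<subseteq> L \<and> module.span smult B = L)"

definition fin_codim :: "'a::field_char_0 poly set \<Rightarrow> 'a poly set \<Rightarrow> bool" where
  "fin_codim L M \<longleftrightarrow> (\<exists>B. finite B \<and> M \<subseteq> module.span smult (L \<union> B))"

definition kpoly_in :: "'a::field_char_0 poly \<Rightarrow> 'a poly set" where
  "kpoly_in f = {pcompose p f | p. True}"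

definition Lfg :: "'a::field_char_0 poly \<Rightarrow> 'a poly \<Rightarrow> 'a poly set" where
  "Lfg f g = {pcompose p f * g | p. True}"

definition is_gf :: "'a::field_char_0 poly \<Rightarrow> 'a poly \<Rightarrow> bool" where
  "is_gf f g \<longleftrightarrow> lead_coeff g = 1 \<and> pderiv f * g \<in> kpoly_in f \<and>
     (\<forall>h. h \<noteq> 0 \<longrightarrow> pderiv f * h \<in> kpoly_in f \<longrightarrow> degree g \<le> degree h)"

definition gf :: "'a::field_char_0 poly \<Rightarrow> 'a poly" where
  "gf f = (THE g. is_gf f g)"

definition Lf :: "'a::field_char_0 poly \<Rightarrow> 'a poly set" where
  "Lf f = Lfg f (gf f)"

definition normalised_pair :: "'a::field_char_0 poly set \<Rightarrow> 'a poly \<Rightarrow> 'a poly \<Rightarrow> bool" where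
  "normalised_pair L f g \<longleftrightarrow>
     degree f \<ge> 1 \<and> lead_coeff f = 1 \<and> poly f 0 = 0 \<and>
     g \<noteq> 0 \<and> lead_coeff g = 1 \<and> pderiv f * g \<in> kpoly_in f \<and>
     Lfg f g \<subseteq> L \<and> L \<subseteq> Lf f \<and>
     (\<forall>h. h \<noteq> 0 \<longrightarrow> pderiv f * h \<in> kpoly_in f \<longrightarrow> Lfg f h \<subseteq> L \<longrightarrow> degree g \<le> degree h)"

end

theory Submission
  imports Defs "HOL-Computational_Algebra.Polynomial_Factorial"
begin

text \<open>Let \<open>M\<close> be the algebra of polynomials \<open>m\<close> with \<open>m L \<subseteq> L\<close>. Since
  \<open>[a,[b,x]] = a b x'' - a' b x' + (a' b' - a b'') x\<close>, a combination of double brackets in which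
  \<open>\<Sum> a b = 0\<close> and \<open>\<Sum> a' b = 0\<close> acts on \<open>L\<close> as multiplication by a polynomial. Writing
  \<open>a\<^sub>0 = a\<close> and \<open>a\<^sub>i\<^sub>+\<^sub>1 = [u, a\<^sub>i]\<close>, the symmetric combination attached to
  \<open>[a,a\<^sub>1]\<otimes>u + u\<otimes>[a,a\<^sub>1] - a\<otimes>a\<^sub>2 - a\<^sub>2\<otimes>a + 2 a\<^sub>1\<otimes>a\<^sub>1\<close> is of this kind, with multiplier \<open>m\<close> given
  by \<open>u\<^sup>2 m = 4 (a\<^sub>2\<^sup>2 - a\<^sub>1 a\<^sub>3)\<close>, which is not constant if \<open>1 < deg u < deg a\<close>.
  A Lueroth argument for subalgebras of \<open>k[t]\<close> gives \<open>f\<close> and \<open>c \<noteq> 0\<close> in \<open>M\<close> with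
  \<open>c k[f] \<subseteq> M \<subseteq> k[f]\<close>, so \<open>k[f] c u \<subseteq> L\<close> for every \<open>u \<in> L\<close>. As \<open>x M' \<subseteq> M\<close> for \<open>x \<in> L\<close>,
  also \<open>f' L \<subseteq> k[f]\<close>, that is, \<open>L \<subseteq> L(f)\<close>. Everything else is division with remainder
  in \<open>k[f]\<close>.\<close>

section \<open>The algebra \<open>k[f]\<close>\<close>

lemma kpoly_in_const [simp]: "[:a:] \<in> kpoly_in f"
  unfolding kpoly_in_def using pcompose_const[of a f] by (metis (mono_tags, lifting) mem_Collect_eq)

lemma kpoly_in_self [simp]: "f \<in> kpoly_in f"
proof -
  have "f = pcompose [:0, 1:] f" by (simp add: pcompose_pCons)
  then show ?thesis unfolding kpoly_in_def by blast
qed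

lemma kpoly_in_pcompose [simp]: "pcompose p f \<in> kpoly_in f"
  unfolding kpoly_in_def by blast

lemma kpoly_in_add: "a \<in> kpoly_in f \<Longrightarrow> b \<in> kpoly_in f \<Longrightarrow> a + b \<in> kpoly_in f"
  unfolding kpoly_in_def using pcompose_add[symmetric] by blast

lemma kpoly_in_diff: "a \<in> kpoly_in f \<Longrightarrow> b \<in> kpoly_in f \<Longrightarrow> a - b \<in> kpoly_in f"
  unfolding kpoly_in_def using pcompose_diff[symmetric] by blast

lemma kpoly_in_mult: "a \<in> kpoly_in f \<Longrightarrow> b \<in> kpoly_in f \<Longrightarrow> a * b \<in> kpoly_in f"
  unfolding kpoly_in_def using pcompose_mult[symmetric] by blast

lemma kpoly_in_smult: "a \<in> kpoly_in f \<Longrightarrow> smult c a \<in> kpoly_in f"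
  unfolding kpoly_in_def using pcompose_smult[symmetric] by blast

lemma kpoly_in_power: "a \<in> kpoly_in f \<Longrightarrow> a ^ n \<in> kpoly_in f"
  by (induction n) (auto intro: kpoly_in_mult simp: one_pCons)

lemma kpoly_in_mono:
  assumes "f \<in> kpoly_in h" shows "kpoly_in f \<subseteq> kpoly_in h"
  using assms by (auto simp: kpoly_in_def pcompose_assoc)

lemma degree_kpoly_in:
  assumes "a \<in> kpoly_in f" shows "degree f dvd degree a"
  using assms by (auto simp: kpoly_in_def degree_pcompose)

text \<open>Division of \<open>q\<close> by \<open>p\<close> with remainder turns
  \<open>a * s\<close> into a polynomial in \<open>f\<close> of degree below that of
  \<open>a\<close>, which forces \<open>s = 0\<close>. Thus a polynomial that is a quotient of two
  elements of k[f] already lies in k[f].\<close>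

lemma kpoly_in_cancel:
  assumes f: "degree f \<ge> 1" and a: "a \<in> kpoly_in f" "a \<noteq> 0" and ah: "a * h \<in> kpoly_in f"
  shows "h \<in> kpoly_in f"
proof -
  obtain p q where p: "a = pcompose p f" and q: "a * h = pcompose q f"
    using a ah by (auto simp: kpoly_in_def)
  have p0: "p \<noteq> 0" using p a by auto
  define s where "s = h - pcompose (q div p) f"
  have "pcompose q f = pcompose (q div p) f * a + pcompose (q mod p) f"
    by (metis p div_mult_mod_eq pcompose_add pcompose_mult)
  then have eq: "a * s = pcompose (q mod p) f"
    using q by (simp add: s_def algebra_simps)
  have "s = 0"
  proof (rule ccontr)
    assume s: "s \<noteq> 0"
    then have "a * s \<noteq> 0" using a by simp
    then have "q mod p \<noteq> 0" using eq by auto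
    then have "degree (q mod p) < degree p" using p0 degree_mod_less' by blast
    then have "degree (q mod p) * degree f < degree p * degree f" using f by simp
    moreover have "degree (a * s) = degree p * degree f + degree s"
      using a s by (simp add: degree_mult_eq p degree_pcompose)
    moreover have "degree (a * s) = degree (q mod p) * degree f"
      by (simp only: eq degree_pcompose)
    ultimately show False by linarith
  qed
  then show ?thesis by (simp add: s_def)
qed

section \<open>Gauss' lemma over k[t]\<close>

lemma irreducible_factor_exists:
  fixes E :: "'a::field poly"
  assumes "degree E > 0"
  obtains r where "irreducible r" "r dvd E" "degree r > 0"
proof -
  define P where "P = (\<lambda>r. r dvd E \<and> degree r > 0)"
  have "P E" using assms by (simp add: P_def)
  then obtain r where r: "P r" and min: "\<And>s. P s \<Longrightarrow> degree r \<le> degree s"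
    using ex_has_least_nat[of P E degree] by auto
  have r0: "r \<noteq> 0" using r by (auto simp: P_def)
  have "irreducible r"
  proof (rule irreducibleI)
    show "r \<noteq> 0" by fact
    show "\<not> r dvd 1" using r r0 by (auto simp: P_def is_unit_iff_degree)
    fix a b assume ab: "r = a * b"
    then have nz: "a \<noteq> 0" "b \<noteq> 0" using r0 by auto
    show "a dvd 1 \<or> b dvd 1"
    proof (rule ccontr)
      assume "\<not> ?thesis"
      then have "degree a > 0" "degree b > 0"
        using nz by (auto simp: is_unit_iff_degree)
      moreover have "a dvd E" using r ab by (auto simp: P_def)
      ultimately have "degree r \<le> degree a" using min by (simp add: P_def)
      then show False using ab nz \<open>degree b > 0\<close> by (simp add: degree_mult_eq)
    qed
  qed
  then show ?thesis using that r by (auto simp: P_def)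
qed

text \<open>Gauss' lemma; the idea is to strip the prime factors of \<open>E\<close> one at a time.\<close>

lemma gauss_factor:
  fixes P Q V :: "'a::field poly poly"
  assumes "E \<noteq> 0" "P * Q = smult E V"
  shows "\<exists>e P1. P = smult e P1 \<and> lead_coeff P1 dvd lead_coeff V"
  using assms
proof (induction "degree E" arbitrary: E P Q rule: less_induct)
  case less
  show ?case
  proof (cases "degree E = 0")
    case True
    then have "E dvd 1" using less.prems is_unit_iff_degree by blast
    then obtain E' where E': "1 = E * E'" by (elim dvdE)
    have "P * smult E' Q = V"
      using less.prems(2) E' by (metis mult_smult_right smult_smult smult_1_left mult.commute)
    then have "lead_coeff P dvd lead_coeff V"
      by (metis dvd_triv_left lead_coeff_mult)
    then show ?thesis by (intro exI[of _ 1] exI[of _ P]) simp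
  next
    case False
    then obtain r where r: "irreducible r" "r dvd E" "degree r > 0"
      using irreducible_factor_exists by blast
    obtain E1 where E1: "E = r * E1" using r by auto
    have nz: "r \<noteq> 0" "E1 \<noteq> 0" using less.prems E1 by auto
    have lt: "degree E1 < degree E" using nz r E1 by (simp add: degree_mult_eq)
    \<comment> \<open>A prime of k[t] stays prime as a constant of k[t][X], so it divides one of the
      two factors and can be cancelled. When it divides \<open>P\<close> it is absorbed into
      \<open>e\<close>.\<close>
    have "prime_elem [:r:]"
      using r field_poly_irreducible_imp_prime lift_prime_elem_poly by blast
    moreover have "[:r:] dvd P * Q"
      unfolding less.prems(2) E1
      by (rule dvdI[of _ _ "smult E1 V"]) (simp add: mult.commute)
    ultimately consider "[:r:] dvd P" | "[:r:] dvd Q"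
      by (auto simp: prime_elem_dvd_mult_iff)
    then show ?thesis
    proof cases
      case 1
      then obtain P' where P': "P = smult r P'" by (auto elim!: dvdE)
      then have "smult r (P' * Q) = smult r (smult E1 V)" using less.prems(2) E1 by simp
      then have "P' * Q = smult E1 V" using nz by (metis smult_cancel)
      from less.hyps[OF lt nz(2) this] obtain e P1
        where "P' = smult e P1" "lead_coeff P1 dvd lead_coeff V" by blast
      then show ?thesis using P' by (intro exI[of _ "r * e"] exI[of _ P1]) simp
    next
      case 2
      then obtain Q' where Q': "Q = smult r Q'" by (auto elim!: dvdE)
      then have "smult r (P * Q') = smult r (smult E1 V)" using less.prems(2) E1 by simp
      then have "P * Q' = smult E1 V" using nz by (metis smult_cancel)
      from less.hyps[OF lt nz(2) this] show ?thesis by blast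
    qed
  qed
qed

section \<open>Multipliers of a Lie subalgebra\<close>

lemma vector_space_smult: "vector_space (smult :: 'a::field \<Rightarrow> 'a poly \<Rightarrow> 'a poly)"
  by unfold_locales (auto simp: smult_add_left smult_add_right)

lemma W1_bracket_bracket:
  "W1_bracket a (W1_bracket b x) =
     a * b * pderiv (pderiv x) - pderiv a * b * pderiv x +
     (pderiv a * pderiv b - a * pderiv (pderiv b)) * x"
  by (simp add: W1_bracket_def pderiv_mult pderiv_diff algebra_simps)

lemma smult_numeral_conv:
  "smult (numeral k) p = numeral k * (p :: 'a::comm_ring_1 poly)"
  "smult (- numeral k) p = - numeral k * (p :: 'a::comm_ring_1 poly)"
  by (simp_all add: numeral_poly)

lemma coeff_mult_at_degree_bounds:
  assumes "degree p \<le> m" "degree q \<le> n"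
  shows "coeff (p * q) (m + n) = coeff p m * coeff q n"
proof -
  have "coeff (p * q) (m + n) = (\<Sum>i\<le>m+n. coeff p i * coeff q (m + n - i))"
    by (simp add: coeff_mult)
  also have "\<dots> = (\<Sum>i\<in>{m}. coeff p i * coeff q (m + n - i))"
  proof (rule sum.mono_neutral_right)
    show "\<forall>i\<in>{..m+n} - {m}. coeff p i * coeff q (m + n - i) = 0"
    proof
      fix i assume i: "i \<in> {..m+n} - {m}"
      show "coeff p i * coeff q (m + n - i) = 0"
      proof (cases "i < m")
        case True
        then have "degree q < m + n - i" using assms by linarith
        then show ?thesis by (simp add: coeff_eq_0)
      next
        case False
        then have "degree p < i" using assms i by auto
        then show ?thesis by (simp add: coeff_eq_0)
      qed
    qed
  qed auto
  finally show ?thesis by simp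
qed

text \<open>The two products contribute deg a and -deg u times the same product of leading
  coefficients, and in characteristic zero deg a > deg u prevents cancellation. Bracketing
  repeatedly with \<open>u\<close> thus gives known degrees and leading coefficients.\<close>

lemma W1_bracket_degree:
  fixes u a :: "'a::field_char_0 poly"
  assumes "degree u \<ge> 1" "degree a > degree u"
  shows "degree (W1_bracket u a) = degree u + degree a - 1"
    and "lead_coeff (W1_bracket u a) = of_nat (degree a - degree u) * lead_coeff u * lead_coeff a"
proof -
  define q p where "q = degree u" and "p = degree a"
  have pq: "1 \<le> q" "q < p" using assms by (auto simp: q_def p_def)
  have nz: "u \<noteq> 0" "a \<noteq> 0" using assms by auto
  have c1: "coeff (u * pderiv a) (q + (p - 1)) = coeff u q * coeff (pderiv a) (p - 1)"
    by (rule coeff_mult_at_degree_bounds) (auto simp: q_def p_def degree_pderiv)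
  have c2: "coeff (pderiv u * a) ((q - 1) + p) = coeff (pderiv u) (q - 1) * coeff a p"
    by (rule coeff_mult_at_degree_bounds) (auto simp: q_def p_def degree_pderiv)
  have e: "q + (p - 1) = q + p - 1" "(q - 1) + p = q + p - 1" using pq by auto
  have d1: "coeff (pderiv a) (p - 1) = of_nat p * coeff a p"
    using pq by (simp add: coeff_pderiv)
  have d2: "coeff (pderiv u) (q - 1) = of_nat q * coeff u q"
    using pq by (simp add: coeff_pderiv)
  have c: "coeff (W1_bracket u a) (q + p - 1) = of_nat (p - q) * coeff u q * coeff a p"
    using c1 c2 pq unfolding e d1 d2 by (simp add: W1_bracket_def of_nat_diff algebra_simps)
  have "coeff (W1_bracket u a) (q + p - 1) \<noteq> 0"
    unfolding c using pq nz by (simp add: p_def q_def)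
  moreover have "degree (W1_bracket u a) \<le> q + p - 1"
    unfolding W1_bracket_def
  proof (rule degree_diff_le)
    show "degree (u * pderiv a) \<le> q + p - 1"
      using degree_mult_le[of u "pderiv a"] pq by (simp add: degree_pderiv q_def p_def)
    show "degree (pderiv u * a) \<le> q + p - 1"
      using degree_mult_le[of "pderiv u" a] pq by (simp add: degree_pderiv q_def p_def)
  qed
  ultimately have d: "degree (W1_bracket u a) = q + p - 1"
    by (simp add: le_antisym le_degree)
  then show "degree (W1_bracket u a) = degree u + degree a - 1"
    by (simp add: q_def p_def)
  show "lead_coeff (W1_bracket u a) = of_nat (degree a - degree u) * lead_coeff u * lead_coeff a"
    unfolding d c by (simp add: q_def p_def)
qed

text \<open>The algebra M from the outline of the proof. It is closed under products, so results on
  subalgebras of k[t] apply to it.\<close>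

definition multipliers :: "'a::field_char_0 poly set \<Rightarrow> 'a poly set" where
  "multipliers L = {m. \<forall>x\<in>L. m * x \<in> L}"

lemma W1_lie_subalgebraD:
  assumes "W1_lie_subalgebra L"
  shows "0 \<in> L" "x \<in> L \<Longrightarrow> y \<in> L \<Longrightarrow> x + y \<in> L" "x \<in> L \<Longrightarrow> smult c x \<in> L"
    "x \<in> L \<Longrightarrow> y \<in> L \<Longrightarrow> x - y \<in> L"
    "x \<in> L \<Longrightarrow> y \<in> L \<Longrightarrow> W1_bracket x y \<in> L"
proof -
  interpret V: vector_space "smult :: 'a \<Rightarrow> 'a poly \<Rightarrow> 'a poly"
    by (rule vector_space_smult)
  have s: "V.subspace L" using assms by (simp add: W1_lie_subalgebra_def)
  show "0 \<in> L" "x \<in> L \<Longrightarrow> y \<in> L \<Longrightarrow> x + y \<in> L" "x \<in> L \<Longrightarrow> smult c x \<in> L"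
    "x \<in> L \<Longrightarrow> y \<in> L \<Longrightarrow> x - y \<in> L"
    using V.subspace_0[OF s] V.subspace_add[OF s] V.subspace_scale[OF s] V.subspace_diff[OF s]
    by auto
  show "x \<in> L \<Longrightarrow> y \<in> L \<Longrightarrow> W1_bracket x y \<in> L"
    using assms by (simp add: W1_lie_subalgebra_def)
qed

text \<open>The commutator of the bracket with \<open>u\<close> and multiplication by
  \<open>m\<close> is multiplication by \<open>u * pderiv m\<close>.\<close>

lemma multipliers_mult_pderiv:
  assumes L: "W1_lie_subalgebra L" and m: "m \<in> multipliers L" and u: "u \<in> L"
  shows "u * pderiv m \<in> multipliers L"
  unfolding multipliers_def
proof (intro CollectI ballI)
  fix x assume x: "x \<in> L"
  have eq: "u * pderiv m * x = W1_bracket u (m * x) - m * W1_bracket u x"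
    by (simp add: W1_bracket_def pderiv_mult algebra_simps)
  have mL: "m * y \<in> L" if "y \<in> L" for y using m that by (auto simp: multipliers_def)
  show "u * pderiv m * x \<in> L"
    unfolding eq by (intro W1_lie_subalgebraD[OF L] mL x u)
qed

lemma nonconstant_multiplier_exists:
  assumes L: "W1_lie_subalgebra L" and u: "u \<in> L" "degree u \<ge> 2"
    and a: "a \<in> L" "degree a > degree u"
  shows "\<exists>m\<in>multipliers L. degree m > 0"
proof -
  define a1 where "a1 = W1_bracket u a"
  define a2 where "a2 = W1_bracket u a1"
  define a3 where "a3 = W1_bracket u a2"
  define b where "b = W1_bracket a a1"
  \<comment> \<open>\<open>mu p q\<close> is the coefficient of \<open>x\<close> in the double
    bracket of \<open>p\<close>, \<open>q\<close> and \<open>x\<close>. It is all that remains once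
    \<open>z2\<close> and \<open>z1\<close> remove the second and first derivatives of
    \<open>x\<close>.\<close>
  define mu where "mu = (\<lambda>p q :: 'a poly. pderiv p * pderiv q - p * pderiv (pderiv q))"
  define m where "m = mu b u + mu u b - mu a a2 - mu a2 a + 2 * mu a1 a1"
  note defs = a3_def b_def a2_def a1_def W1_bracket_def
  have inL: "a1 \<in> L" "a2 \<in> L" "b \<in> L"
    by (auto simp: a1_def a2_def b_def intro!: W1_lie_subalgebraD[OF L] u a)
  have z2: "b * u + u * b - a * a2 - a2 * a + 2 * (a1 * a1) = 0"
    by (simp add: defs pderiv_mult pderiv_diff pderiv_add algebra_simps)
  have z1: "pderiv b * u + pderiv u * b - pderiv a * a2 - pderiv a2 * a + 2 * (pderiv a1 * a1) = 0"
    by (simp add: defs pderiv_mult pderiv_diff pderiv_add algebra_simps)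
  have "m \<in> multipliers L"
    unfolding multipliers_def
  proof (intro CollectI ballI)
    fix x assume x: "x \<in> L"
    have "W1_bracket b (W1_bracket u x) + W1_bracket u (W1_bracket b x)
       - W1_bracket a (W1_bracket a2 x) - W1_bracket a2 (W1_bracket a x)
       + 2 * W1_bracket a1 (W1_bracket a1 x)
       = (b * u + u * b - a * a2 - a2 * a + 2 * (a1 * a1)) * pderiv (pderiv x)
       - (pderiv b * u + pderiv u * b - pderiv a * a2 - pderiv a2 * a + 2 * (pderiv a1 * a1)) * pderiv x
       + m * x"
      unfolding W1_bracket_bracket m_def mu_def by (simp add: algebra_simps)
    then have eq: "m * x = W1_bracket b (W1_bracket u x) + W1_bracket u (W1_bracket b x)
       - W1_bracket a (W1_bracket a2 x) - W1_bracket a2 (W1_bracket a x)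
       + smult 2 (W1_bracket a1 (W1_bracket a1 x))"
      unfolding z1 z2 smult_numeral_conv by simp
    show "m * x \<in> L"
      unfolding eq by (intro W1_lie_subalgebraD[OF L] x u a inL)
  qed
  moreover have key: "u ^ 2 * m = 4 * (a2 ^ 2 - a1 * a3)"
    unfolding m_def mu_def
    by (simp add: defs pderiv_mult pderiv_diff pderiv_add) (simp add: algebra_simps power2_eq_square)
  moreover have "degree m > 0"
  proof -
    define j k where "j = degree a - degree u" and "k = degree u - 1"
    have jk: "j > 0" "k > 0" "degree u = k + 1" "degree a = j + k + 1"
      using u a by (auto simp: j_def k_def)
    define \<mu> \<alpha> where "\<mu> = lead_coeff u" and "\<alpha> = lead_coeff a"
    have nz: "\<mu> \<noteq> 0" "\<alpha> \<noteq> 0" using u a by (auto simp: \<mu>_def \<alpha>_def)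
    have d1: "degree a1 = j + 2 * k + 1" "lead_coeff a1 = of_nat j * \<mu> * \<alpha>"
      unfolding a1_def using W1_bracket_degree[of u a] jk by (auto simp: \<mu>_def \<alpha>_def)
    have d2: "degree a2 = j + 3 * k + 1" "lead_coeff a2 = of_nat (j + k) * \<mu> * (of_nat j * \<mu> * \<alpha>)"
      unfolding a2_def using W1_bracket_degree[of u a1] jk d1 by (auto simp: \<mu>_def)
    have d3: "degree a3 = j + 4 * k + 1"
      "lead_coeff a3 = of_nat (j + 2 * k) * \<mu> * (of_nat (j + k) * \<mu> * (of_nat j * \<mu> * \<alpha>))"
      unfolding a3_def using W1_bracket_degree[of u a2] jk d2 by (auto simp: \<mu>_def)
    define D where "D = (j + 3 * k + 1) + (j + 3 * k + 1)"
    have D': "D = (j + 2 * k + 1) + (j + 4 * k + 1)" by (simp add: D_def)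
    have "coeff (a2 ^ 2) D = lead_coeff a2 * lead_coeff a2"
      unfolding D_def power2_eq_square d2(1)[symmetric] by (rule coeff_mult_degree_sum)
    moreover have "coeff (a1 * a3) D = lead_coeff a1 * lead_coeff a3"
      unfolding D' d1(1)[symmetric] d3(1)[symmetric] by (rule coeff_mult_degree_sum)
    ultimately have "coeff (a2 ^ 2 - a1 * a3) D =
        of_nat (j + k) * \<mu> * (of_nat j * \<mu> * \<alpha>) * (of_nat (j + k) * \<mu> * (of_nat j * \<mu> * \<alpha>)) -
        of_nat j * \<mu> * \<alpha> * (of_nat (j + 2 * k) * \<mu> * (of_nat (j + k) * \<mu> * (of_nat j * \<mu> * \<alpha>)))"
      by (simp only: coeff_diff d1(2) d2(2) d3(2))
    \<comment> \<open>After common factors are taken out, (j + k) - (j + 2k) = -k is left. It is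
      nonzero because deg u > 1, so the leading terms of \<open>a2 ^ 2\<close> and
      \<open>a1 * a3\<close> do not cancel.\<close>
    also have "\<dots> = - of_nat (j + k) * of_nat j ^ 2 * of_nat k * \<mu> ^ 4 * \<alpha> ^ 2"
      by (simp add: algebra_simps power2_eq_square power4_eq_xxxx)
    finally have "coeff (a2 ^ 2 - a1 * a3) D \<noteq> 0"
      using jk nz by (simp flip: of_nat_add)
    then have ge: "degree (a2 ^ 2 - a1 * a3) \<ge> D" and nz': "a2 ^ 2 - a1 * a3 \<noteq> 0"
      by (auto simp: le_degree)
    have "4 * (a2 ^ 2 - a1 * a3) = smult 4 (a2 ^ 2 - a1 * a3)"
      by (simp only: smult_numeral_conv)
    then have "degree (u ^ 2 * m) \<ge> D" "u ^ 2 * m \<noteq> 0"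
      using key ge nz' by (auto simp del: smult_diff_right)
    \<comment> \<open>This leaves deg m at least 2j + 4k.\<close>
    then have "2 * degree u + degree m \<ge> D"
      by (auto simp: degree_mult_eq degree_power_eq)
    then show ?thesis using jk by (simp add: D_def)
  qed
  ultimately show ?thesis by blast
qed

section \<open>Lueroth's theorem for subalgebras of \<open>k[t]\<close>\<close>

locale poly_subalgebra =
  fixes M :: "'a::field_char_0 poly set"
  assumes one: "1 \<in> M"
    and add: "\<And>x y. x \<in> M \<Longrightarrow> y \<in> M \<Longrightarrow> x + y \<in> M"
    and mult: "\<And>x y. x \<in> M \<Longrightarrow> y \<in> M \<Longrightarrow> x * y \<in> M"
    and scale: "\<And>c x. x \<in> M \<Longrightarrow> smult c x \<in> M"
    and nonconst: "\<exists>m\<in>M. degree m > 0"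
begin

lemma const: "[:c:] \<in> M"
  using scale[OF one, of c] by simp

lemma zero: "0 \<in> M"
  using const[of 0] by simp

lemma diff: "x \<in> M \<Longrightarrow> y \<in> M \<Longrightarrow> x - y \<in> M"
  using add[of x "smult (-1) y"] scale[of y "-1"] by simp

lemma power: "x \<in> M \<Longrightarrow> x ^ n \<in> M"
  by (induction n) (auto intro: one mult)

text \<open>The degrees form an additive semigroup \<open>S\<close>. Take for \<open>n\<close> the
  least positive difference of two elements of \<open>S\<close>; if some \<open>x\<close> in
  \<open>S\<close> were not a multiple of \<open>n\<close>, then \<open>x mod n\<close> would be a
  smaller such difference.\<close>

lemma degree_structure:
  "\<exists>n N. n > 0 \<and> (\<forall>m\<in>M. n dvd degree m) \<and> (\<forall>k\<ge>N. \<exists>m\<in>M. m \<noteq> 0 \<and> degree m = k * n)"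
proof -
  define S where "S = degree ` (M - {0})"
  have S0: "0 \<in> S" using one by (force simp: S_def)
  have Sadd: "x + y \<in> S" if "x \<in> S" "y \<in> S" for x y
  proof -
    from that obtain p q where "p \<in> M" "q \<in> M" "p \<noteq> 0" "q \<noteq> 0" "x = degree p" "y = degree q"
      by (auto simp: S_def)
    then show ?thesis using mult[of p q] by (auto simp: S_def degree_mult_eq intro!: image_eqI[of _ _ "p * q"])
  qed
  have Smult: "k * x \<in> S" if "x \<in> S" for k x
    by (induction k) (auto intro: S0 Sadd that)
  obtain m0 where m0: "m0 \<in> M" "degree m0 > 0" using nonconst by auto
  have sm: "degree m0 \<in> S" using m0 by (auto simp: S_def)
  define P where "P = (\<lambda>n. n > 0 \<and> (\<exists>s\<in>S. s + n \<in> S))"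
  have "P (degree m0)" using m0 sm S0 by (auto simp: P_def intro!: bexI[of _ 0])
  then obtain n where Pn: "P n" and min: "\<And>r. P r \<Longrightarrow> n \<le> r"
    using LeastI[of P] Least_le[of P] by metis
  then obtain s where n0: "n > 0" and s: "s \<in> S" "s + n \<in> S" by (auto simp: P_def)
  have dvd: "n dvd x" if x: "x \<in> S" for x
  proof (rule ccontr)
    assume "\<not> n dvd x"
    then have r: "0 < x mod n" "x mod n < n" using n0 by (auto simp: dvd_eq_mod_eq_0)
    have "(x div n) * (s + n) \<in> S" using Smult s by blast
    moreover have "x + (x div n) * s \<in> S" using Sadd Smult s x by blast
    moreover have "x + (x div n) * s = (x div n) * (s + n) + x mod n"
      using div_mult_mod_eq[of x n] by (simp add: algebra_simps)
    ultimately have "P (x mod n)" using r by (auto simp: P_def)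
    then show False using min r by fastforce
  qed
  \<comment> \<open>Both \<open>s0\<close> and \<open>s0 + n\<close>, which is twice
    \<open>s + n\<close>, lie in \<open>S\<close>, and \<open>s0\<close> is positive even when
    \<open>s = 0\<close>.\<close>
  define s0 where "s0 = s + (s + n)"
  have s0: "s0 \<in> S" "s0 + n \<in> S" "s0 > 0"
    using Sadd[OF s(1) s(2)] Sadd[OF s(2) s(2)] n0 by (auto simp: s0_def algebra_simps)
  obtain b where b: "s0 = n * b" using dvd[OF s0(1)] by auto
  then have b0: "b > 0" using s0 by auto
  \<comment> \<open>The bound \<open>b * b\<close> makes the quotient at least \<open>b\<close>,
    hence larger than the remainder \<open>r\<close>, so that \<open>q - r\<close> copies of
    \<open>s0\<close> and \<open>r\<close> copies of \<open>s0 + n\<close> can be used.\<close>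
  have large: "k * n \<in> S" if k: "k \<ge> b * b" for k
  proof -
    define q r where "q = k div b" and "r = k mod b"
    have r: "r < b" and qb: "q \<ge> b" and kk: "k = q * b + r"
      using b0 k div_le_mono[OF k, of b] by (auto simp: q_def r_def)
    have qr: "r \<le> q" using r qb by simp
    have "(q - r) * s0 + r * (s0 + n) \<in> S" using Sadd Smult s0 by blast
    moreover have "(q - r) * s0 + r * (s0 + n) = ((q - r) + r) * s0 + r * n"
      by (simp only: algebra_simps)
    moreover have "\<dots> = k * n" using qr by (simp add: b kk algebra_simps)
    ultimately show ?thesis by simp
  qed
  have "\<forall>m\<in>M. n dvd degree m" using dvd by (force simp: S_def)
  moreover have "\<forall>k\<ge>b*b. \<exists>m\<in>M. m \<noteq> 0 \<and> degree m = k * n" using large by (force simp: S_def)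
  ultimately show ?thesis using n0 by blast
qed

end

section \<open>Algebraic relations of t over the subalgebra M\<close>

definition poly_var :: "'a::comm_semiring_1 poly" where
  "poly_var = [:0, 1:]"

lemma degree_mult_poly_var_power:
  "w \<noteq> 0 \<Longrightarrow> degree (w * poly_var ^ i) = degree (w :: 'a::field poly) + i"
  by (simp add: degree_mult_eq poly_var_def degree_power_eq)

lemma poly_sum_upto:
  fixes W :: "'a::comm_ring_1 poly"
  assumes "\<And>i. i \<ge> n \<Longrightarrow> coeff W i = 0"
  shows "poly W x = (\<Sum>i<n. coeff W i * x ^ i)"
proof -
  have "poly W x = (\<Sum>i\<le>degree W. coeff W i * x ^ i)" by (rule poly_altdef)
  also have "\<dots> = (\<Sum>i\<in>{..degree W} \<union> {..<n}. coeff W i * x ^ i)"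
    by (rule sum.mono_neutral_left) (auto simp: coeff_eq_0)
  also have "\<dots> = (\<Sum>i<n. coeff W i * x ^ i)"
    by (rule sum.mono_neutral_right) (auto simp: assms not_less)
  finally show ?thesis .
qed

locale poly_subalgebra_degree = poly_subalgebra M for M :: "'a::field_char_0 poly set" +
  fixes n N :: nat
  assumes n_pos: "n > 0" and n_dvd: "\<And>m. m \<in> M \<Longrightarrow> n dvd degree m"
    and large_degrees: "\<And>k. k \<ge> N \<Longrightarrow> \<exists>m\<in>M. m \<noteq> 0 \<and> degree m = k * n"
begin

text \<open>\<open>MX\<close> is the ring M[X] inside k[t][X], and \<open>MXn\<close> is its part of
  degree below \<open>n\<close>. Evaluating \<open>MXn\<close> at X = t gives the M-module spanned
  by 1, t, ..., t^(n-1).\<close>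

definition MX :: "'a poly poly set" where
  "MX = {W. \<forall>i. coeff W i \<in> M}"

definition MXn :: "'a poly poly set" where
  "MXn = {W\<in>MX. \<forall>i\<ge>n. coeff W i = 0}"

lemma MX_add: "V \<in> MX \<Longrightarrow> W \<in> MX \<Longrightarrow> V + W \<in> MX"
  by (auto simp: MX_def add)

lemma MX_diff: "V \<in> MX \<Longrightarrow> W \<in> MX \<Longrightarrow> V - W \<in> MX"
  by (auto simp: MX_def diff)

lemma MX_smult: "c \<in> M \<Longrightarrow> W \<in> MX \<Longrightarrow> smult c W \<in> MX"
  by (auto simp: MX_def mult)

lemma MX_monom: "c \<in> M \<Longrightarrow> monom c i \<in> MX"
  by (auto simp: MX_def zero)

lemma MX_monom_mult: "c \<in> M \<Longrightarrow> W \<in> MX \<Longrightarrow> monom c i * W \<in> MX"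
  by (auto simp: MX_def zero coeff_monom_mult mult)

lemma MXn_add: "V \<in> MXn \<Longrightarrow> W \<in> MXn \<Longrightarrow> V + W \<in> MXn"
  by (auto simp: MXn_def MX_add)

lemma MXn_diff: "V \<in> MXn \<Longrightarrow> W \<in> MXn \<Longrightarrow> V - W \<in> MXn"
  by (auto simp: MXn_def MX_diff)

lemma MXn_smult: "c \<in> M \<Longrightarrow> W \<in> MXn \<Longrightarrow> smult c W \<in> MXn"
  by (auto simp: MXn_def MX_smult)

text \<open>The degrees of the nonzero terms \<open>coeff W i * t^i\<close> differ modulo \<open>n\<close>, so nothing cancels.\<close>

lemma MXn_eval_degree:
  assumes W: "W \<in> MXn" and nz: "W \<noteq> 0"
  shows "poly W poly_var \<noteq> 0"
    and "coeff W i \<noteq> 0 \<Longrightarrow> degree (coeff W i) + i \<le> degree (poly W poly_var)"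
proof -
  define I where "I = {i. coeff W i \<noteq> 0}"
  have I: "I \<subseteq> {..<n}" using W by (auto simp: I_def MXn_def not_le[symmetric])
  then have fin: "finite I" by (rule finite_subset) simp
  have "I \<noteq> {}" using nz by (auto simp: I_def poly_eq_iff)
  define d where "d = (\<lambda>i. degree (coeff W i) + i)"
  have dvd: "n dvd degree (coeff W i)" for i using W n_dvd by (auto simp: MXn_def MX_def)
  have inj: "inj_on d I"
  proof (rule inj_onI)
    fix i j assume ij: "i \<in> I" "j \<in> I" "d i = d j"
    have "d k mod n = k" if "k \<in> I" for k
    proof -
      obtain e where "degree (coeff W k) = n * e" using dvd[of k] by (elim dvdE)
      then show ?thesis using that I by (auto simp: d_def)
    qed
    then show "i = j" using ij by metis
  qed
  have "Max (d ` I) \<in> d ` I" using fin \<open>I \<noteq> {}\<close> by simp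
  then obtain i0 where i0: "i0 \<in> I" "d i0 = Max (d ` I)" by auto
  have le: "d i \<le> d i0" if "i \<in> I" for i using that fin i0 by simp
  have lt: "d i < d i0" if "i \<in> I" "i \<noteq> i0" for i
    using le[OF that(1)] inj that i0 by (metis inj_onD le_neq_implies_less)
  have "poly W poly_var = (\<Sum>i<n. coeff W i * poly_var ^ i)"
    using W by (intro poly_sum_upto) (auto simp: MXn_def)
  also have "\<dots> = (\<Sum>i\<in>I. coeff W i * poly_var ^ i)"
    using I by (intro sum.mono_neutral_right) (auto simp: I_def)
  finally have eq: "poly W poly_var = (\<Sum>i\<in>I. coeff W i * poly_var ^ i)" .
  have "coeff (poly W poly_var) (d i0) = (\<Sum>i\<in>I. coeff (coeff W i * poly_var ^ i) (d i0))"
    unfolding eq by (simp add: coeff_sum)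
  also have "\<dots> = (\<Sum>i\<in>{i0}. coeff (coeff W i * poly_var ^ i) (d i0))"
  proof (rule sum.mono_neutral_right[OF fin])
    show "{i0} \<subseteq> I" using i0 by simp
    show "\<forall>i\<in>I - {i0}. coeff (coeff W i * poly_var ^ i) (d i0) = 0"
    proof
      fix i assume i: "i \<in> I - {i0}"
      then have "degree (coeff W i * poly_var ^ i) = d i"
        by (simp add: I_def d_def degree_mult_poly_var_power)
      then show "coeff (coeff W i * poly_var ^ i) (d i0) = 0" using lt i by (simp add: coeff_eq_0)
    qed
  qed
  also have "\<dots> = lead_coeff (coeff W i0 * poly_var ^ i0)"
    using i0 by (simp add: I_def d_def degree_mult_poly_var_power)
  also have "\<dots> \<noteq> 0" using i0 by (simp add: I_def poly_var_def)
  finally have c: "coeff (poly W poly_var) (d i0) \<noteq> 0" .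
  then show "poly W poly_var \<noteq> 0" by auto
  have "d i0 \<le> degree (poly W poly_var)" using c by (rule le_degree)
  then show "degree (coeff W i) + i \<le> degree (poly W poly_var)" if "coeff W i \<noteq> 0"
    using le[of i] that by (simp add: I_def d_def)
qed

text \<open>A leading term of degree k n + i with k at least \<open>N\<close> is cancelled by a
  multiple of m t^i, where \<open>m\<close> in M has degree k n. So this M-module has finite
  codimension in k[t].\<close>

lemma reduce_mod_MXn:
  "\<exists>W\<in>MXn. \<forall>i\<ge>N * n. coeff (q - poly W poly_var) i = 0"
proof (induction "degree q" arbitrary: q rule: less_induct)
  case less
  show ?case
  proof (cases "degree q < N * n")
    case True
    then show ?thesis by (intro bexI[of _ 0]) (auto simp: coeff_eq_0 MXn_def MX_def zero)
  next
    case False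
    define k i where "k = degree q div n" and "i = degree q mod n"
    have ki: "degree q = k * n + i" "i < n" using n_pos by (auto simp: k_def i_def)
    have "N \<le> k" using False n_pos div_le_mono[of "N * n" "degree q" n] by (simp add: k_def)
    then obtain m where m: "m \<in> M" "m \<noteq> 0" "degree m = k * n" using large_degrees by blast
    define e where "e = m * poly_var ^ i"
    have de: "degree e = degree q" using m ki by (simp add: e_def degree_mult_poly_var_power)
    have e0: "e \<noteq> 0" using m by (simp add: e_def poly_var_def)
    define l where "l = lead_coeff q / lead_coeff e"
    define q' where "q' = q - smult l e"
    define W0 where "W0 = monom (smult l m) i"
    have W0: "W0 \<in> MXn" using ki m by (auto simp: W0_def MXn_def intro!: MX_monom scale)
    have pW0: "poly W0 poly_var = smult l e" by (simp add: W0_def poly_monom e_def)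
    have "coeff e (degree q) \<noteq> 0" using e0 de by (metis leading_coeff_0_iff)
    then have top: "coeff q' (degree q) = 0" by (simp add: q'_def l_def de)
    have le: "degree q' \<le> degree q" unfolding q'_def
      using de by (intro degree_diff_le) (auto intro: order.trans[OF degree_smult_le])
    show ?thesis
    proof (cases "q' = 0")
      case True
      then show ?thesis using W0 pW0 by (intro bexI[of _ W0]) (auto simp: q'_def)
    next
      case False
      then have "degree q' < degree q" using top le
        by (metis leading_coeff_0_iff le_neq_implies_less)
      from less[OF this] obtain W where W: "W \<in> MXn" "\<forall>i\<ge>N * n. coeff (q' - poly W poly_var) i = 0"
        by blast
      have "q - poly (W0 + W) poly_var = q' - poly W poly_var" by (simp add: q'_def pW0)
      then show ?thesis using W W0 by (intro bexI[of _ "W0 + W"] MXn_add) (simp_all only:)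
    qed
  qed
qed

text \<open>Linear relations among the finitely many low coefficients of the remainders are removed
  one coefficient at a time, keeping multipliers \<open>c\<close> of arbitrarily large degree.\<close>

lemma relation_exists_aux:
  assumes "d \<le> N * n"
  shows "\<exists>c\<in>M. degree c > B \<and> (\<exists>W\<in>MXn. \<forall>i\<ge>N * n - d. coeff (c * poly_var ^ n - poly W poly_var) i = 0)"
  using assms
proof (induction d arbitrary: B)
  case 0
  have "N \<le> N + B + 1" by simp
  from large_degrees[OF this] obtain c where "c \<in> M" "degree c = (N + B + 1) * n" by blast
  moreover have "(N + B + 1) * n > B"
    using n_pos by (cases n) auto
  ultimately show ?case using reduce_mod_MXn[of "c * poly_var ^ n"]
    by (intro bexI[of _ c]) simp_all
next
  case (Suc d)
  define j where "j = N * n - Suc d"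
  have j: "N * n - d = Suc j" using Suc.prems by (simp add: j_def)
  obtain c1 W1 where 1: "c1 \<in> M" "degree c1 > B" "W1 \<in> MXn"
    "\<forall>i\<ge>Suc j. coeff (c1 * poly_var ^ n - poly W1 poly_var) i = 0"
    using Suc.IH[of B] Suc.prems unfolding j by auto
  \<comment> \<open>With \<open>c2\<close> of larger degree than \<open>c1\<close>, the combination
    \<open>c2 - smult l c1\<close> keeps the degree of \<open>c2\<close>, so the new multiplier
    still exceeds \<open>B\<close>.\<close>
  obtain c2 W2 where 2: "c2 \<in> M" "degree c2 > degree c1" "W2 \<in> MXn"
    "\<forall>i\<ge>Suc j. coeff (c2 * poly_var ^ n - poly W2 poly_var) i = 0"
    using Suc.IH[of "degree c1"] Suc.prems unfolding j by auto
  define r1 r2 where "r1 = c1 * poly_var ^ n - poly W1 poly_var" and "r2 = c2 * poly_var ^ n - poly W2 poly_var"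
  show ?case
  proof (cases "coeff r1 j = 0")
    case True
    then have "\<forall>i\<ge>j. coeff r1 i = 0" using 1 by (metis r1_def le_eq_less_or_eq Suc_leI)
    then show ?thesis using 1 by (auto simp: j_def r1_def)
  next
    case False
    define l where "l = coeff r2 j / coeff r1 j"
    define c where "c = c2 - smult l c1"
    define W where "W = W2 - smult [:l:] W1"
    have eq: "c * poly_var ^ n - poly W poly_var = r2 - smult l r1"
      by (simp add: c_def W_def r1_def r2_def algebra_simps smult_diff_right)
    have "\<forall>i\<ge>j. coeff (c * poly_var ^ n - poly W poly_var) i = 0"
    proof (intro allI impI)
      fix i assume "i \<ge> j"
      then consider "i = j" | "i \<ge> Suc j" by linarith
      then show "coeff (c * poly_var ^ n - poly W poly_var) i = 0"
        unfolding eq using 1 2 False by cases (auto simp: l_def r1_def r2_def)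
    qed
    moreover have "c \<in> M" using 1 2 by (auto simp: c_def intro: diff scale)
    moreover have "W \<in> MXn" using 1 2 by (auto simp: W_def intro!: MXn_diff MXn_smult const)
    moreover have "degree c = degree c2" unfolding c_def
      using 2 degree_smult_le[of l c1] by (simp add: diff_conv_add_uminus degree_add_eq_left del: add_uminus_conv_diff)
    ultimately show ?thesis using 1 2 unfolding j_def by (intro bexI[of _ c]) auto
  qed
qed

text \<open>Once all \<open>N * n\<close> low coefficients are removed the remainder is zero. This
  shows that t has degree at most \<open>n\<close> over the fraction field of M.\<close>

lemma relation_exists:
  "\<exists>c\<in>M. c \<noteq> 0 \<and> (\<exists>W\<in>MXn. c * poly_var ^ n = poly W poly_var)"
proof -
  obtain c W where "c \<in> M" "degree c > 0" "W \<in> MXn" "\<forall>i. coeff (c * poly_var ^ n - poly W poly_var) i = 0"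
    using relation_exists_aux[of "N * n" 0] by auto
  moreover from this have "c * poly_var ^ n = poly W poly_var" "c \<noteq> 0" by (auto simp: poly_eq_iff[of "_ * _"])
  ultimately show ?thesis by blast
qed

text \<open>By \<open>MXn_eval_degree\<close> no nonzero element of M[X] of degree below
  \<open>n\<close> vanishes at t, so \<open>monom c n - W\<close> is, up to the factor
  \<open>c\<close>, the minimal polynomial of t over the fraction field of M. Each division step
  multiplies by \<open>c\<close> to stay inside M[X].\<close>

lemma pseudo_divide:
  assumes c: "c \<in> M" "c \<noteq> 0" and W: "W \<in> MXn" and rel: "c * poly_var ^ n = poly W poly_var"
    and V: "V \<in> MX" "poly V poly_var = 0"
  shows "\<exists>s Q. smult (c ^ s) V = Q * (monom c n - W)"
  using V
proof (induction "degree V" arbitrary: V rule: less_induct)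
  case less
  define P where "P = monom c n - W"
  have PMX: "P \<in> MX" using c W by (auto simp: P_def MXn_def intro: MX_diff MX_monom)
  have P0: "poly P poly_var = 0" using rel by (simp add: P_def poly_monom)
  have cP: "coeff P n = c" using W by (simp add: P_def MXn_def)
  have dP: "degree P = n"
  proof (rule antisym)
    show "degree P \<le> n" using W by (intro degree_le) (auto simp: P_def MXn_def)
    show "n \<le> degree P" using cP c by (intro le_degree) simp
  qed
  show ?case
  proof (cases "degree V < n")
    case True
    then have "V \<in> MXn" using less.prems by (auto simp: MXn_def coeff_eq_0)
    then have "V = 0" using MXn_eval_degree(1) less.prems by blast
    then show ?thesis by (intro exI[of _ 0]) simp
  next
    case False
    define T where "T = monom (lead_coeff V) (degree V - n)"
    define V' where "V' = smult c V - T * P"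
    have lM: "lead_coeff V \<in> M" using less.prems by (simp add: MX_def)
    have V'MX: "V' \<in> MX" unfolding V'_def T_def
      using less.prems c lM PMX by (intro MX_diff MX_smult MX_monom_mult)
    have V'0: "poly V' poly_var = 0" using less.prems P0 by (simp add: V'_def)
    have "coeff V' i = 0" if "i \<ge> degree V" for i
    proof (cases "i = degree V")
      case True
      then show ?thesis using False cP by (simp add: V'_def T_def coeff_monom_mult)
    next
      case i: False
      then have "degree P < i - (degree V - n)" "degree V < i" using that False dP by auto
      then show ?thesis by (simp add: V'_def T_def coeff_monom_mult coeff_eq_0)
    qed
    then have "V' = 0 \<or> degree V' < degree V"
      by (metis leading_coeff_0_iff not_le)
    then have "\<exists>s Q. smult (c ^ s) V' = Q * P"
    proof
      assume "V' = 0" then show ?thesis by (intro exI[of _ 0]) simp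
    next
      assume "degree V' < degree V"
      from less.hyps[OF this V'MX V'0] show ?thesis by (simp add: P_def)
    qed
    then obtain s Q where sQ: "smult (c ^ s) V' = Q * P" by blast
    have "smult (c ^ Suc s) V = smult (c ^ s) V' + smult (c ^ s) (T * P)"
      by (simp add: V'_def smult_diff_right mult.commute)
    also have "\<dots> = (Q + smult (c ^ s) T) * P" by (simp add: sQ algebra_simps)
    finally show ?thesis unfolding P_def by blast
  qed
qed

text \<open>The coefficients of the minimal polynomial of \<open>t\<close> over the fraction field of \<open>M\<close> are
  polynomials by Gauss' lemma; all but the constant one have degree \<open>< n\<close> and divisible by \<open>n\<close>,
  hence are scalars, and the constant one is the generator.\<close>

lemma generator_exists:
  "\<exists>f c. degree f = n \<and> c \<in> M \<and> c \<noteq> 0 \<and> c * f \<in> M"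
proof -
  obtain c W where c: "c \<in> M" "c \<noteq> 0" and W: "W \<in> MXn" and rel: "c * poly_var ^ n = poly W poly_var"
    using relation_exists by blast
  define P where "P = monom c n - W"
  obtain m where m: "m \<in> M" "degree m > 0" using nonconst by blast
  \<comment> \<open>This is m(X) - m(t) in M[X]. It vanishes at X = t, and its leading coefficient
    is a nonzero scalar, which is what makes Gauss' lemma yield a factor with unit leading
    coefficient.\<close>
  define V where "V = map_poly (\<lambda>a. [:a:]) m - [:m:]"
  have cV: "coeff V i = [:coeff m i:] - coeff [:m:] i" for i
    by (simp add: V_def coeff_map_poly)
  have VMX: "V \<in> MX"
    using m by (auto simp: MX_def cV coeff_pCons split: nat.splits intro!: diff const)
  have V0: "poly V poly_var = 0"
    by (simp add: V_def pcompose_altdef[symmetric] poly_var_def)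
  have cVm: "coeff V (degree m) = [:lead_coeff m:]" using m by (simp add: cV coeff_eq_0)
  have m0: "m \<noteq> 0" using m by auto
  have dV: "degree V = degree m"
  proof (rule antisym)
    show "degree V \<le> degree m"
      using m by (intro degree_le) (auto simp: cV coeff_eq_0 coeff_pCons split: nat.splits)
    show "degree m \<le> degree V"
      using m0 by (intro le_degree) (simp add: cVm)
  qed
  have lV: "lead_coeff V dvd 1"
    using m0 unfolding dV cVm by (simp add: is_unit_iff_degree)
  obtain s Q where "smult (c ^ s) V = Q * P"
    using pseudo_divide[OF c W rel VMX V0] unfolding P_def by blast
  then have "P * Q = smult (c ^ s) V" by (simp add: mult.commute)
  then obtain e P1 where P1: "P = smult e P1" "lead_coeff P1 dvd lead_coeff V"
    using gauss_factor[of "c ^ s" P Q V] c by (metis power_not_zero)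
  have cPn: "coeff P n = c" using W by (simp add: P_def MXn_def)
  have dP: "degree P = n"
  proof (rule antisym)
    show "degree P \<le> n" using W by (intro degree_le) (auto simp: P_def MXn_def)
    show "n \<le> degree P" using cPn c by (intro le_degree) simp
  qed
  have e0: "e \<noteq> 0" using P1 cPn c by auto
  then have dP1: "degree P1 = n" using dP P1 by simp
  have "lead_coeff P1 dvd 1" using P1 lV dvd_trans by blast
  then obtain r where r: "1 = coeff P1 n * r" unfolding dP1 by (elim dvdE)
  have ce: "c = e * coeff P1 n" using cPn P1 by simp
  \<comment> \<open>\<open>F i\<close> is the quotient of \<open>coeff W i\<close> by
    \<open>c\<close>; it is a polynomial because the leading coefficient of \<open>P1\<close> has
    the inverse \<open>r\<close>.\<close>
  define F where "F = (\<lambda>i. if i < n then - (r * coeff P1 i) else 0)"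
  have cF: "c * F i = coeff W i" for i
  proof (cases "i < n")
    case True
    have "c * F i = - (e * coeff P1 i) * (coeff P1 n * r)" using True by (simp add: F_def ce)
    also have "\<dots> = - coeff P i" unfolding r[symmetric] by (simp add: P1)
    also have "\<dots> = coeff W i" using True by (simp add: P_def)
    finally show ?thesis .
  next
    case False
    then show ?thesis using W by (simp add: F_def MXn_def)
  qed
  have "poly W poly_var = (\<Sum>i<n. coeff W i * poly_var ^ i)"
    using W by (intro poly_sum_upto) (auto simp: MXn_def)
  also have "\<dots> = c * (\<Sum>i<n. F i * poly_var ^ i)"
    by (simp add: cF[symmetric] sum_distrib_left mult.assoc)
  finally have tn: "poly_var ^ n = (\<Sum>i<n. F i * poly_var ^ i)"
    using rel c by simp
  have W0: "W \<noteq> 0" using rel c by (auto simp: poly_var_def)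
  have degF: "degree (F i) = 0" if i: "0 < i" "i < n" for i
  proof (cases "F i = 0")
    case False
    have "coeff W i \<noteq> 0" using False c cF[of i] by auto
    then have "degree (coeff W i) + i \<le> degree (poly W poly_var)"
      using MXn_eval_degree(2)[OF W W0] by blast
    also have "\<dots> = degree c + n" using c by (simp add: rel[symmetric] degree_mult_poly_var_power)
    finally have lt: "degree (F i) < n"
      using False c i by (simp add: cF[symmetric] degree_mult_eq)
    have "n dvd degree (c * F i)" unfolding cF using W n_dvd by (auto simp: MXn_def MX_def)
    then have "n dvd degree (F i)"
      using False c n_dvd[of c] by (simp add: degree_mult_eq dvd_add_right_iff)
    then show ?thesis using lt by (auto dest: dvd_imp_le)
  qed simp
  have "poly_var ^ n = F 0 + (\<Sum>i\<in>{0<..<n}. F i * poly_var ^ i)"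
  proof -
    have "{..<n} = insert 0 {0<..<n}" using n_pos by auto
    then show ?thesis unfolding tn by simp
  qed
  \<comment> \<open>The other coefficients being scalars, only powers of t below \<open>n\<close>
    are subtracted, so \<open>F 0\<close> has degree exactly \<open>n\<close>.\<close>
  then have F0: "F 0 = poly_var ^ n - (\<Sum>i\<in>{0<..<n}. F i * poly_var ^ i)" by simp
  have "degree (\<Sum>i\<in>{0<..<n}. F i * poly_var ^ i) < n"
  proof (rule degree_sum_less[OF _ n_pos])
    fix i assume i: "i \<in> {0<..<n}"
    show "degree (F i * poly_var ^ i) < n"
      using i degF[of i] degree_mult_poly_var_power[of "F i" i] by (cases "F i = 0") auto
  qed
  moreover have "degree (poly_var ^ n :: 'a poly) = n"
    by (simp add: poly_var_def degree_power_eq)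
  ultimately have "degree (F 0) = n"
    unfolding F0 by (simp add: diff_conv_add_uminus degree_add_eq_left del: add_uminus_conv_diff)
  moreover have "c * F 0 \<in> M" unfolding cF using W by (auto simp: MXn_def MX_def)
  ultimately show ?thesis using c by blast
qed

text \<open>\<open>A\<close> consists of the polynomials in the fraction field of M. Their degrees
  are multiples of n = deg f and \<open>A\<close> contains \<open>f\<close>, so subtracting scalar
  multiples of powers of \<open>f\<close> reduces each of them to a polynomial in
  \<open>f\<close>.\<close>

lemma luroth_degree:
  "\<exists>f c. degree f = n \<and> M \<subseteq> kpoly_in f \<and> c \<in> M \<and> c \<noteq> 0 \<and> (\<forall>q\<in>kpoly_in f. c * q \<in> M)"
proof -
  obtain f c where f: "degree f = n" and c: "c \<in> M" "c \<noteq> 0" and cf: "c * f \<in> M"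
    using generator_exists by blast
  have f0: "f \<noteq> 0" using f n_pos by auto
  define A where "A = {q. \<exists>b\<in>M. b \<noteq> 0 \<and> b * q \<in> M}"
  have A_degree: "n dvd degree q" if q: "q \<in> A" "q \<noteq> 0" for q
  proof -
    obtain b where b: "b \<in> M" "b \<noteq> 0" "b * q \<in> M" using q by (auto simp: A_def)
    then show ?thesis using n_dvd[of b] n_dvd[of "b * q"] q
      by (simp add: degree_mult_eq dvd_add_right_iff)
  qed
  have cfk: "c ^ k * f ^ k \<in> M" for k
    using power[OF cf, of k] by (simp add: power_mult_distrib)
  have A_k: "q \<in> kpoly_in f" if "q \<in> A" for q
    using that
  proof (induction "degree q" arbitrary: q rule: less_induct)
    case less
    show ?case
    proof (cases "degree q = 0")
      case True
      then obtain a where "q = [:a:]" by (elim degree_eq_zeroE)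
      then show ?thesis by simp
    next
      case False
      then have q0: "q \<noteq> 0" by auto
      obtain k where k: "degree q = n * k" using A_degree less.prems q0 by (auto elim: dvdE)
      define l where "l = lead_coeff q / lead_coeff (f ^ k)"
      define q' where "q' = q - smult l (f ^ k)"
      have dk: "degree (f ^ k) = degree q" using f f0 k by (simp add: degree_power_eq mult.commute)
      have "lead_coeff (f ^ k) \<noteq> 0" using f0 by simp
      then have "coeff q' (degree q) = 0" unfolding q'_def l_def dk by (simp add: l_def dk)
      moreover have "degree q' \<le> degree q" unfolding q'_def
        using dk by (intro degree_diff_le) (auto intro: order.trans[OF degree_smult_le])
      ultimately have lt: "degree q' < degree q" using False
        by (metis leading_coeff_0_iff le_neq_implies_less degree_0)
      obtain b where b: "b \<in> M" "b \<noteq> 0" "b * q \<in> M" using less.prems by (auto simp: A_def)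
      have "b * c ^ k * q' = c ^ k * (b * q) - smult l (b * (c ^ k * f ^ k))"
        by (simp add: q'_def algebra_simps)
      also have "\<dots> \<in> M" by (intro diff mult[OF _ b(3)] mult[OF b(1) cfk] scale power c)
      finally have "b * c ^ k * q' \<in> M" .
      moreover have "b * c ^ k \<in> M" "b * c ^ k \<noteq> 0" using b c by (auto intro: mult power)
      ultimately have "q' \<in> A" unfolding A_def by blast
      then have "q' \<in> kpoly_in f" using less.hyps lt by blast
      then have "q' + smult l (f ^ k) \<in> kpoly_in f"
        by (intro kpoly_in_add kpoly_in_smult kpoly_in_power) simp_all
      then show ?thesis by (simp add: q'_def)
    qed
  qed
  have MA: "M \<subseteq> A" using one by (auto simp: A_def intro!: bexI[of _ 1])
  obtain m where m: "m \<in> M" "degree m > 0" using nonconst by blast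
  obtain b where b: "degree m = n * b" using n_dvd[OF m(1)] by (elim dvdE)
  have b0: "b > 0" using m b by auto
  have cond: "c ^ b * q \<in> M" if "q \<in> kpoly_in f" for q
    using that
  proof (induction "degree q" arbitrary: q rule: less_induct)
    case less
    show ?case
    proof (cases "degree q = 0")
      case True
      then obtain a where "q = [:a:]" by (elim degree_eq_zeroE)
      then show ?thesis using c by (auto intro: scale power)
    next
      case False
      then have q0: "q \<noteq> 0" by auto
      obtain k where k: "degree q = n * k" using degree_kpoly_in[OF less.prems] f by (auto elim: dvdE)
      define i j where "i = k div b" and "j = k mod b"
      have ij: "k = b * i + j" "j < b" using b0 by (auto simp: i_def j_def)
      \<comment> \<open>Over k[m], k[f] is spanned by the powers f^j with j < b. Since
        \<open>c * f\<close> is in M, the single factor \<open>c ^ b\<close> carries all of them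
        into M.\<close>
      define h where "h = m ^ i * f ^ j"
      have m0: "m \<noteq> 0" using m by auto
      have dh: "degree h = degree q"
        using f f0 m0 k b ij by (simp add: h_def degree_mult_eq degree_power_eq algebra_simps)
      have h0: "lead_coeff h \<noteq> 0" using f0 m0 by (simp add: h_def)
      define l where "l = lead_coeff q / lead_coeff h"
      define q' where "q' = q - smult l h"
      have "coeff q' (degree q) = 0" using h0 unfolding q'_def l_def dh by simp
      moreover have "degree q' \<le> degree q" unfolding q'_def
        using dh by (intro degree_diff_le) (auto intro: order.trans[OF degree_smult_le])
      ultimately have lt: "degree q' < degree q" using False
        by (metis leading_coeff_0_iff le_neq_implies_less degree_0)
      have "h \<in> kpoly_in f" unfolding h_def
        using m MA A_k by (intro kpoly_in_mult kpoly_in_power) auto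
      then have "q' \<in> kpoly_in f" unfolding q'_def
        using less.prems by (intro kpoly_in_diff kpoly_in_smult)
      then have 1: "c ^ b * q' \<in> M" using less.hyps lt by blast
      have "c ^ b = c ^ (b - j) * c ^ j" using ij by (simp flip: power_add)
      then have "c ^ b * h = m ^ i * (c ^ (b - j) * (c ^ j * f ^ j))"
        by (simp add: h_def mult_ac)
      also have "\<dots> \<in> M" by (intro mult[OF _ mult[OF _ cfk]] power m c)
      finally have "c ^ b * h \<in> M" .
      moreover have "c ^ b * q = c ^ b * q' + smult l (c ^ b * h)"
        by (simp add: q'_def algebra_simps)
      ultimately show ?thesis using 1 by (auto intro!: add scale)
    qed
  qed
  show ?thesis using f MA A_k c cond power[OF c(1), of b]
    by (intro exI[of _ f] exI[of _ "c ^ b"]) auto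
qed

end

theorem (in poly_subalgebra) luroth:
  "\<exists>f c. degree f \<ge> 1 \<and> M \<subseteq> kpoly_in f \<and> c \<in> M \<and> c \<noteq> 0 \<and> (\<forall>q\<in>kpoly_in f. c * q \<in> M)"
proof -
  obtain n N where nN: "n > 0" "\<forall>m\<in>M. n dvd degree m" "\<forall>k\<ge>N. \<exists>m\<in>M. m \<noteq> 0 \<and> degree m = k * n"
    using degree_structure by blast
  interpret poly_subalgebra_degree M n N
    by unfold_locales (use nN in auto)
  obtain f c where "degree f = n" "M \<subseteq> kpoly_in f" "c \<in> M" "c \<noteq> 0" "\<forall>q\<in>kpoly_in f. c * q \<in> M"
    using luroth_degree by blast
  then show ?thesis using n_pos by (intro exI[of _ f] exI[of _ c]) simp
qed

section \<open>Subalgebras of the Witt algebra\<close>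

text \<open>Induction on the bound: the kernel of the top coefficient has codimension at most one,
  so one more basis vector suffices.\<close>

lemma bounded_degree_fin_dim:
  fixes U :: "'a::field_char_0 poly set"
  assumes "module.subspace smult U" "\<And>x. x \<in> U \<Longrightarrow> \<forall>i\<ge>d. coeff x i = 0"
  shows "fin_dim U"
  using assms
proof (induction d arbitrary: U)
  case 0
  interpret V: vector_space "smult :: 'a \<Rightarrow> 'a poly \<Rightarrow> 'a poly" by (rule vector_space_smult)
  have "U = {0}" using V.subspace_0[OF 0(1)] 0(2) by (auto simp: poly_eq_iff)
  then show ?case unfolding fin_dim_def by (intro exI[of _ "{}"]) simp
next
  case (Suc d)
  interpret V: vector_space "smult :: 'a \<Rightarrow> 'a poly \<Rightarrow> 'a poly" by (rule vector_space_smult)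
  note sub = Suc.prems(1)
  define U' where "U' = {x\<in>U. coeff x d = 0}"
  have "V.subspace U'"
    using V.subspace_0[OF sub] V.subspace_add[OF sub] V.subspace_scale[OF sub]
    by (auto simp: U'_def V.subspace_def)
  moreover have "\<forall>i\<ge>d. coeff x i = 0" if "x \<in> U'" for x
  proof (intro allI impI)
    fix i assume "d \<le> i"
    then consider "i = d" | "Suc d \<le> i" by linarith
    then show "coeff x i = 0" using that Suc.prems(2)[of x] by cases (auto simp: U'_def)
  qed
  ultimately have "fin_dim U'" by (rule Suc.IH)
  then obtain B where B: "finite B" "B \<subseteq> U'" "V.span B = U'" by (auto simp: fin_dim_def)
  show ?case
  proof (cases "U' = U")
    case True
    then show ?thesis using \<open>fin_dim U'\<close> by simp
  next
    case False
    then obtain b where b: "b \<in> U" "coeff b d \<noteq> 0" by (auto simp: U'_def)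
    have "V.span (insert b B) = U"
    proof (rule antisym)
      show "V.span (insert b B) \<subseteq> U"
        using B b sub by (intro V.span_minimal) (auto simp: U'_def)
      show "U \<subseteq> V.span (insert b B)"
      proof
        fix x assume x: "x \<in> U"
        define l where "l = coeff x d / coeff b d"
        have "x - smult l b \<in> U'"
          using x b V.subspace_diff[OF sub] V.subspace_scale[OF sub] by (auto simp: U'_def l_def)
        then have "x - smult l b \<in> V.span B" using B by simp
        then have "x - smult l b \<in> V.span (insert b B)" using V.span_mono[of B "insert b B"] by blast
        moreover have "smult l b \<in> V.span (insert b B)" by (intro V.span_scale V.span_base) simp
        ultimately have "(x - smult l b) + smult l b \<in> V.span (insert b B)" by (rule V.span_add)
        then show "x \<in> V.span (insert b B)" by simp
      qed
    qed
    then show ?thesis using B b unfolding fin_dim_def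
      by (intro exI[of _ "insert b B"]) (auto simp: U'_def)
  qed
qed

lemma infinite_dim_unbounded_degree:
  assumes "module.subspace smult U" "\<not> fin_dim U"
  shows "\<exists>x\<in>U. degree x > d"
proof (rule ccontr)
  assume "\<not> ?thesis"
  then have "degree x \<le> d" if "x \<in> U" for x using that by (simp add: not_less)
  then have "\<forall>i\<ge>Suc d. coeff x i = 0" if "x \<in> U" for x
    using that by (metis coeff_eq_0 le_imp_less_Suc less_le_trans)
  then show False using bounded_degree_fin_dim assms by blast
qed

lemma poly_subalgebra_multipliers:
  assumes L: "W1_lie_subalgebra L" and inf: "\<not> fin_dim L"
  shows "poly_subalgebra (multipliers L)"
proof
  show "1 \<in> multipliers L" by (simp add: multipliers_def)
  show "x + y \<in> multipliers L" if "x \<in> multipliers L" "y \<in> multipliers L" for x y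
    using that W1_lie_subalgebraD(2)[OF L] by (auto simp: multipliers_def distrib_right)
  show "x * y \<in> multipliers L" if "x \<in> multipliers L" "y \<in> multipliers L" for x y
    using that by (auto simp: multipliers_def mult.assoc)
  show "smult c x \<in> multipliers L" if "x \<in> multipliers L" for c x
    using that W1_lie_subalgebraD(3)[OF L] by (auto simp: multipliers_def)
  have sub: "module.subspace smult L" using L by (simp add: W1_lie_subalgebra_def)
  obtain u where u: "u \<in> L" "degree u > 1" using infinite_dim_unbounded_degree[OF sub inf] by blast
  obtain a where a: "a \<in> L" "degree a > degree u" using infinite_dim_unbounded_degree[OF sub inf] by blast
  show "\<exists>m\<in>multipliers L. degree m > 0"
    using nonconstant_multiplier_exists[OF L u(1) _ a] u by simp
qed

section \<open>The k[f]-modules L(f,g) and L(f)\<close>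

lemma Lfg_image: "Lfg f g = (\<lambda>a. a * g) ` kpoly_in f"
  by (auto simp: Lfg_def kpoly_in_def)

lemma generator_in_Lfg: "g \<in> Lfg f g"
  unfolding Lfg_image by (rule image_eqI[of _ _ "[:1:]"]) simp_all

lemma infinite_dim_contains_Lfg:
  assumes L: "W1_lie_subalgebra L" and inf: "\<not> fin_dim L"
  shows "\<exists>f g. degree f \<ge> 1 \<and> g \<noteq> 0 \<and> Lfg f g \<subseteq> L \<and> (\<forall>x\<in>L. pderiv f * x \<in> kpoly_in f)"
proof -
  interpret M: poly_subalgebra "multipliers L"
    by (rule poly_subalgebra_multipliers[OF L inf])
  obtain f c where f: "degree f \<ge> 1" and Mf: "multipliers L \<subseteq> kpoly_in f"
    and c: "c \<in> multipliers L" "c \<noteq> 0" and cond: "\<forall>q\<in>kpoly_in f. c * q \<in> multipliers L"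
    using M.luroth by blast
  have sub: "module.subspace smult L" using L by (simp add: W1_lie_subalgebra_def)
  obtain u where u: "u \<in> L" "degree u > 0" using infinite_dim_unbounded_degree[OF sub inf] by blast
  have "Lfg f (c * u) \<subseteq> L"
  proof
    fix y assume "y \<in> Lfg f (c * u)"
    then obtain q where q: "q \<in> kpoly_in f" "y = q * (c * u)" by (auto simp: Lfg_image)
    then have "(c * q) * u \<in> L" using cond u by (auto simp: multipliers_def)
    then show "y \<in> L" by (simp add: q mult_ac)
  qed
  moreover have "c * u \<noteq> 0" using c u by auto
  moreover have "pderiv f * x \<in> kpoly_in f" if x: "x \<in> L" for x
  proof (rule kpoly_in_cancel[OF f, of c])
    \<comment> \<open>Both \<open>c\<close> and \<open>c * f\<close> are multipliers, so their
      derivatives times \<open>x\<close> are again multipliers and lie in k[f]. The product rule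
      isolates \<open>c * pderiv f * x\<close>, and \<open>c\<close> is then cancelled.\<close>
    have "x * pderiv c \<in> kpoly_in f" "x * pderiv (c * f) \<in> kpoly_in f"
      using multipliers_mult_pderiv[OF L _ x] c cond Mf by auto
    then have "x * pderiv (c * f) - (x * pderiv c) * f \<in> kpoly_in f"
      using kpoly_in_diff kpoly_in_mult kpoly_in_self by blast
    then show "c * (pderiv f * x) \<in> kpoly_in f" by (simp add: pderiv_mult algebra_simps)
  qed (use c Mf in auto)
  ultimately show ?thesis using f by blast
qed

text \<open>Since \<open>f' h = p(f)\<close> identifies \<open>h\<close> with \<open>p\<close>, submodules correspond to ideals of \<open>k[x]\<close>,
  and an element of minimal degree generates.\<close>

lemma submodule_generated_by_minimal:
  assumes f: "degree f \<ge> 1" and S: "\<And>h. h \<in> S \<Longrightarrow> pderiv f * h \<in> kpoly_in f"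
    and diff: "\<And>h k. h \<in> S \<Longrightarrow> k \<in> S \<Longrightarrow> h - k \<in> S"
    and mult: "\<And>a h. a \<in> kpoly_in f \<Longrightarrow> h \<in> S \<Longrightarrow> a * h \<in> S"
    and g: "g \<in> S" "g \<noteq> 0" and min: "\<And>h. h \<in> S \<Longrightarrow> h \<noteq> 0 \<Longrightarrow> degree g \<le> degree h"
  shows "S \<subseteq> Lfg f g"
proof
  fix h assume h: "h \<in> S"
  obtain p q where p: "pderiv f * g = pcompose p f" and q: "pderiv f * h = pcompose q f"
    using S[OF g(1)] S[OF h] by (auto simp: kpoly_in_def)
  have f'0: "pderiv f \<noteq> 0" using f by (auto simp: pderiv_eq_0_iff)
  have p0: "p \<noteq> 0" using p f'0 g by auto
  define s where "s = h - pcompose (q div p) f * g"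
  have sS: "s \<in> S" unfolding s_def by (intro diff mult h g) simp
  have "pcompose q f = pcompose (q div p) f * (pderiv f * g) + pcompose (q mod p) f"
    by (metis p div_mult_mod_eq pcompose_add pcompose_mult)
  then have eq: "pderiv f * s = pcompose (q mod p) f"
    using q by (simp add: s_def algebra_simps)
  have "s = 0"
  proof (rule ccontr)
    assume s: "s \<noteq> 0"
    then have "pderiv f * s \<noteq> 0" using f'0 by simp
    then have "q mod p \<noteq> 0" using eq by auto
    then have "degree (q mod p) < degree p" using p0 degree_mod_less' by blast
    then have "degree (q mod p) * degree f < degree p * degree f" using f by simp
    moreover have "degree (pderiv f) + degree s = degree (q mod p) * degree f"
      using f'0 s by (metis eq degree_pcompose degree_mult_eq)
    moreover have "degree (pderiv f) + degree g = degree p * degree f"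
      using f'0 g by (metis p degree_pcompose degree_mult_eq)
    ultimately show False using min[OF sS s] by linarith
  qed
  then have "h = pcompose (q div p) f * g" by (simp add: s_def)
  then show "h \<in> Lfg f g" by (auto simp: Lfg_def)
qed

text \<open>The degree bound makes the factor p(f) a scalar, and comparing leading coefficients
  makes it 1.\<close>

lemma Lfg_monic_unique:
  assumes f: "degree f \<ge> 1" and h: "h \<in> Lfg f g" and monic: "lead_coeff g = 1" "lead_coeff h = 1"
    and le: "degree h \<le> degree g"
  shows "h = g"
proof -
  obtain p where p: "h = pcompose p f * g" using h by (auto simp: Lfg_def)
  have nz: "g \<noteq> 0" "pcompose p f \<noteq> 0" using monic p by auto
  then have "degree (pcompose p f) = 0" using le p by (simp add: degree_mult_eq)
  then have "degree p = 0" using f by (simp add: degree_pcompose)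
  then obtain a where "p = [:a:]" by (elim degree_eq_zeroE)
  then have "h = smult a g" using p by simp
  then show ?thesis using monic by (metis lead_coeff_smult mult.right_neutral smult_1_left)
qed

lemma monic_minimal_exists:
  fixes S :: "'a::field poly set"
  assumes scale: "\<And>c h. h \<in> S \<Longrightarrow> smult c h \<in> S" and h: "h \<in> S" "h \<noteq> 0"
  shows "\<exists>g\<in>S. lead_coeff g = 1 \<and> (\<forall>k\<in>S. k \<noteq> 0 \<longrightarrow> degree g \<le> degree k)"
proof -
  obtain g where g: "g \<in> S" "g \<noteq> 0" and min: "\<And>k. k \<in> S \<Longrightarrow> k \<noteq> 0 \<Longrightarrow> degree g \<le> degree k"
    using ex_has_least_nat[of "\<lambda>k. k \<in> S \<and> k \<noteq> 0" h degree] h by blast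
  then show ?thesis using scale[of g "1 / lead_coeff g"]
    by (intro bexI[of _ "smult (1 / lead_coeff g) g"]) auto
qed

text \<open>The witness \<open>h\<close> provides a monic element of minimal degree; it generates
  all \<open>k\<close> with \<open>pderiv f * k\<close> in k[f]. Any two such generators coincide,
  so the definite description in \<open>gf\<close> selects this one.\<close>

lemma Lf_eq:
  assumes f: "degree f \<ge> 1" and h: "h \<noteq> 0" "pderiv f * h \<in> kpoly_in f"
  shows "Lf f = {k. pderiv f * k \<in> kpoly_in f}"
proof -
  define S where "S = {k. pderiv f * k \<in> kpoly_in f}"
  have "\<exists>g\<in>S. lead_coeff g = 1 \<and> (\<forall>k\<in>S. k \<noteq> 0 \<longrightarrow> degree g \<le> degree k)"
    by (rule monic_minimal_exists[of S h]) (use h in \<open>auto simp: S_def kpoly_in_smult\<close>)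
  then obtain g where g: "is_gf f g" by (auto simp: S_def is_gf_def)
  have gen: "S \<subseteq> Lfg f k" if k: "is_gf f k" for k
  proof (rule submodule_generated_by_minimal[OF f])
    show "a * h \<in> S" if "a \<in> kpoly_in f" "h \<in> S" for a h
      using that kpoly_in_mult[of a f "pderiv f * h"] by (simp add: S_def mult_ac)
  qed (use k in \<open>auto simp: S_def is_gf_def right_diff_distrib kpoly_in_diff\<close>)
  have "k = g" if k: "is_gf f k" for k
  proof (rule Lfg_monic_unique[OF f])
    show "k \<in> Lfg f g" using gen[OF g] k by (auto simp: S_def is_gf_def)
    have "g \<noteq> 0" using g by (auto simp: is_gf_def)
    then show "degree k \<le> degree g" using k g by (auto simp: is_gf_def)
  qed (use k g in \<open>auto simp: is_gf_def\<close>)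
  then have eq: "gf f = g" unfolding gf_def using g by (intro the_equality) blast+
  have "Lfg f g \<subseteq> S"
  proof
    fix y assume "y \<in> Lfg f g"
    then obtain a where "a \<in> kpoly_in f" "y = a * g" by (auto simp: Lfg_image)
    then show "y \<in> S" using g kpoly_in_mult[of a f "pderiv f * g"] by (simp add: S_def is_gf_def mult_ac)
  qed
  then show "Lf f = {k. pderiv f * k \<in> kpoly_in f}"
    using gen[OF g] eq by (auto simp: Lf_def S_def)
qed

section \<open>Affine changes of f and comparison of two pairs\<close>

lemma kpoly_in_affine:
  assumes "\<alpha> \<noteq> 0" shows "kpoly_in (smult \<alpha> f + [:\<beta>:]) = kpoly_in f"
proof (rule antisym)
  show "kpoly_in (smult \<alpha> f + [:\<beta>:]) \<subseteq> kpoly_in f"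
    by (intro kpoly_in_mono kpoly_in_add kpoly_in_smult) simp_all
  have "f = smult (1 / \<alpha>) ((smult \<alpha> f + [:\<beta>:]) - [:\<beta>:])" using assms by simp
  also have "\<dots> \<in> kpoly_in (smult \<alpha> f + [:\<beta>:])"
    by (intro kpoly_in_smult kpoly_in_diff) simp_all
  finally show "kpoly_in f \<subseteq> kpoly_in (smult \<alpha> f + [:\<beta>:])" by (rule kpoly_in_mono)
qed

lemma pderiv_affine_mult_in_kpoly_in:
  assumes "\<alpha> \<noteq> 0"
  shows "pderiv (smult \<alpha> f + [:\<beta>:]) * h \<in> kpoly_in (smult \<alpha> f + [:\<beta>:])
     \<longleftrightarrow> pderiv f * h \<in> kpoly_in f"
proof -
  have "pderiv f * h \<in> kpoly_in f" if "smult \<alpha> (pderiv f * h) \<in> kpoly_in f"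
    using kpoly_in_smult[OF that, of "1 / \<alpha>"] assms by simp
  then show ?thesis
    using assms kpoly_in_smult[of "pderiv f * h" f \<alpha>]
    by (simp add: kpoly_in_affine pderiv_add pderiv_smult pderiv_pCons) blast
qed

lemma Lfg_affine: "\<alpha> \<noteq> 0 \<Longrightarrow> Lfg (smult \<alpha> f + [:\<beta>:]) g = Lfg f g"
  by (simp add: Lfg_image kpoly_in_affine)

lemma Lf_affine: "\<alpha> \<noteq> 0 \<Longrightarrow> Lf (smult \<alpha> f + [:\<beta>:]) = Lf f"
  by (simp add: Lf_def Lfg_affine gf_def is_gf_def pderiv_affine_mult_in_kpoly_in)

text \<open>Here \<open>f'\<close> is a second polynomial, not a derivative. Both \<open>g'\<close>
  and \<open>f' * g'\<close> are multiples of \<open>g\<close> by elements of k[f], so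
  \<open>f'\<close> is a quotient of two elements of k[f].\<close>

lemma Lfg_subset_Lfg_imp_in_kpoly_in:
  assumes f: "degree f \<ge> 1" and g': "g' \<noteq> 0" and sub: "Lfg f' g' \<subseteq> Lfg f g"
  shows "f' \<in> kpoly_in f"
proof -
  have "f' * g' \<in> Lfg f' g'" by (auto simp: Lfg_image)
  then obtain b where b: "b \<in> kpoly_in f" "f' * g' = b * g" using sub by (auto simp: Lfg_image)
  obtain a where a: "a \<in> kpoly_in f" "g' = a * g"
    using sub generator_in_Lfg[of g' f'] by (auto simp: Lfg_image)
  have "g \<noteq> 0" "a \<noteq> 0" using a g' by auto
  have "(a * f') * g = b * g" using a b by (simp add: mult_ac)
  then have "a * f' = b" using \<open>g \<noteq> 0\<close> by simp
  then show ?thesis using kpoly_in_cancel[OF f a(1) \<open>a \<noteq> 0\<close>] b by simp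
qed

text \<open>Composing the two expressions multiplies degrees, so deg q deg p = 1 and
  \<open>p\<close> is linear.\<close>

lemma mutual_kpoly_in_imp_affine:
  assumes "degree f \<ge> 1" "f' \<in> kpoly_in f" "f \<in> kpoly_in f'"
  shows "\<exists>\<alpha> \<beta>. \<alpha> \<noteq> 0 \<and> f' = smult \<alpha> f + [:\<beta>:]"
proof -
  obtain p q where p: "f' = pcompose p f" and q: "f = pcompose q f'"
    using assms by (auto simp: kpoly_in_def)
  have "degree f = degree q * degree p * degree f"
    by (metis p q degree_pcompose mult.assoc)
  then have dp: "degree p = 1" using assms by simp
  define \<alpha> \<beta> where "\<alpha> = coeff p 1" and "\<beta> = coeff p 0"
  have pp: "p = [:\<beta>, \<alpha>:]"
    using dp by (intro poly_eqI) (auto simp: \<alpha>_def \<beta>_def coeff_pCons coeff_eq_0 split: nat.splits)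
  have "\<alpha> \<noteq> 0" using dp by (metis \<alpha>_def leading_coeff_0_iff degree_0 zero_neq_one)
  moreover have "f' = smult \<alpha> f + [:\<beta>:]" by (simp add: p pp pcompose_pCons)
  ultimately show ?thesis by blast
qed

text \<open>With g = q(f) h, division by \<open>q\<close> writes p(f) h as an element of L(f,g) plus
  r(f) h, where \<open>r\<close> is the remainder.\<close>

lemma fin_codim_Lfg:
  assumes sub: "Lfg f g \<subseteq> L" and g: "g \<noteq> 0"
    and h: "g \<in> Lfg f h"
  shows "fin_codim L (Lfg f h)"
proof -
  interpret V: vector_space "smult :: 'a \<Rightarrow> 'a poly \<Rightarrow> 'a poly" by (rule vector_space_smult)
  obtain q where q: "g = pcompose q f * h" using h by (auto simp: Lfg_def)
  have q0: "q \<noteq> 0" using q g by auto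
  \<comment> \<open>The index \<open>degree q\<close> is included so that the remainder 0, of degree
    0, is also covered when \<open>q\<close> is constant.\<close>
  define B where "B = (\<lambda>i. f ^ i * h) ` {..degree q}"
  have "Lfg f h \<subseteq> V.span (L \<union> B)"
  proof
    fix y assume "y \<in> Lfg f h"
    then obtain p where p: "y = pcompose p f * h" by (auto simp: Lfg_def)
    define r where "r = p mod q"
    have "pcompose p f = pcompose (p div q) f * pcompose q f + pcompose r f"
      by (metis r_def div_mult_mod_eq pcompose_add pcompose_mult)
    then have "y = pcompose (p div q) f * g + pcompose r f * h"
      by (simp add: p q algebra_simps)
    moreover have "pcompose (p div q) f * g \<in> V.span (L \<union> B)"
      using sub by (intro V.span_base) (auto simp: Lfg_def)
    moreover have "pcompose r f * h \<in> V.span (L \<union> B)"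
    proof -
      have "r = 0 \<or> degree r < degree q" unfolding r_def using q0 degree_mod_less by blast
      then have "degree r \<le> degree q" by auto
      have "pcompose r f = (\<Sum>i\<le>degree r. smult (coeff r i) (f ^ i))"
        by (simp add: pcompose_altdef poly_altdef degree_map_poly coeff_map_poly)
      then have "pcompose r f * h = (\<Sum>i\<le>degree r. smult (coeff r i) (f ^ i * h))"
        by (simp add: sum_distrib_right)
      also have "\<dots> \<in> V.span (L \<union> B)"
        using \<open>degree r \<le> degree q\<close>
        by (intro V.span_sum V.span_scale V.span_base) (auto simp: B_def)
      finally show ?thesis .
    qed
    ultimately show "y \<in> V.span (L \<union> B)" by (simp add: V.span_add)
  qed
  then show ?thesis unfolding fin_codim_def by (intro exI[of _ B]) (auto simp: B_def)
qed

section \<open>Existence, normalisation and uniqueness of the pair (f, g)\<close>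

theorem mainTheorem2:
  fixes L :: "'a::field_char_0 poly set"
  assumes "W1_lie_subalgebra L" and "\<not> fin_dim L"
  shows "\<exists>f g. degree f \<ge> 1 \<and> g \<noteq> 0 \<and> pderiv f * g \<in> kpoly_in f \<and>
            Lfg f g \<subseteq> L \<and> L \<subseteq> Lf f \<and> fin_codim L (Lf f) \<and>
            normalised_pair L f g \<and>
            (\<forall>f' g'. normalised_pair L f' g' \<longrightarrow> f' = f \<and> g' = g) \<and>
            (\<forall>f' g'. degree f' \<ge> 1 \<longrightarrow> g' \<noteq> 0 \<longrightarrow> pderiv f' * g' \<in> kpoly_in f' \<longrightarrow>
                 Lfg f' g' \<subseteq> L \<longrightarrow> L \<subseteq> Lf f' \<longrightarrow>
                 (\<exists>\<alpha> \<beta>. \<alpha> \<noteq> 0 \<and> f' = smult \<alpha> f + [:\<beta>:]) \<and>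
                 (\<exists>p. g' = pcompose p f * g) \<and>
                 Lf f' = Lf f \<and> Lfg f' g' \<subseteq> Lfg f g)"
proof -
  note L = W1_lie_subalgebraD[OF assms(1)]
  obtain f0 g0 where f0: "degree f0 \<ge> 1" and g0: "g0 \<noteq> 0" "Lfg f0 g0 \<subseteq> L"
    and L0: "\<forall>x\<in>L. pderiv f0 * x \<in> kpoly_in f0"
    using infinite_dim_contains_Lfg[OF assms] by blast
  \<comment> \<open>These constants make \<open>f\<close> monic with value 0 at 0; an affine change
    leaves k[f] unchanged.\<close>
  define \<gamma> \<delta> where "\<gamma> = 1 / lead_coeff f0" and "\<delta> = - \<gamma> * poly f0 0"
  have \<gamma>: "\<gamma> \<noteq> 0" using f0 by (auto simp: \<gamma>_def)
  define f where "f = smult \<gamma> f0 + [:\<delta>:]"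
  have df: "degree f = degree f0" using f0 \<gamma> by (simp add: f_def degree_add_eq_left)
  then have f: "degree f \<ge> 1" using f0 by simp
  have "lead_coeff f = \<gamma> * lead_coeff f0"
    unfolding df using f0 by (simp add: f_def coeff_pCons split: nat.splits)
  then have f_monic: "lead_coeff f = 1" using f0 by (auto simp: \<gamma>_def)
  have f_0: "poly f 0 = 0" by (simp add: f_def \<delta>_def)
  have Lg0: "Lfg f g0 \<subseteq> L" using g0 \<gamma> by (simp add: f_def Lfg_affine)
  have Lk: "pderiv f * x \<in> kpoly_in f" if "x \<in> L" for x
    using that L0 \<gamma> by (simp add: f_def pderiv_affine_mult_in_kpoly_in)
  have g0L: "g0 \<in> L" using Lg0 generator_in_Lfg by blast
  have Lf_f: "Lf f = {k. pderiv f * k \<in> kpoly_in f}"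
    using Lf_eq[OF f g0(1)] Lk g0L by blast
  have LLf: "L \<subseteq> Lf f" using Lk by (auto simp: Lf_f)
  \<comment> \<open>\<open>S\<close> is the largest k[f]-submodule contained in \<open>L\<close>;
    its monic generator of least degree is the required \<open>g\<close>.\<close>
  define S where "S = {h. Lfg f h \<subseteq> L}"
  have SL: "S \<subseteq> L" using generator_in_Lfg by (auto simp: S_def)
  have S_mult: "a * h \<in> S" if a: "a \<in> kpoly_in f" and h: "h \<in> S" for a h
  proof -
    have "Lfg f (a * h) \<subseteq> Lfg f h"
      using a by (auto simp: Lfg_image mult.assoc[symmetric] kpoly_in_mult)
    then show ?thesis using h by (auto simp: S_def)
  qed
  have S_scale: "smult c h \<in> S" if "h \<in> S" for c h
    using S_mult[of "[:c:]" h] that by simp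
  have S_diff: "h - k \<in> S" if "h \<in> S" "k \<in> S" for h k
    using that L(4) by (auto simp: S_def Lfg_def right_diff_distrib image_subset_iff)
  have "g0 \<in> S" using Lg0 by (simp add: S_def)
  then obtain g where g: "g \<in> S" "lead_coeff g = 1"
    and min: "\<And>k. k \<in> S \<Longrightarrow> k \<noteq> 0 \<Longrightarrow> degree g \<le> degree k"
    using monic_minimal_exists[of S g0] S_scale g0 by blast
  have g_nz: "g \<noteq> 0" using g by auto
  have S_gen: "S \<subseteq> Lfg f g"
    using SL Lk by (intro submodule_generated_by_minimal[OF f _ S_diff S_mult g(1) g_nz min]) auto
  have Lg: "Lfg f g \<subseteq> L" and fg: "pderiv f * g \<in> kpoly_in f" using g Lk SL by (auto simp: S_def)
  have codim: "fin_codim L (Lf f)" unfolding Lf_def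
  proof (rule fin_codim_Lfg[OF Lg g_nz])
    show "g \<in> Lfg f (gf f)" using SL g LLf by (auto simp: Lf_def)
  qed
  have norm: "normalised_pair L f g"
    unfolding normalised_pair_def
    using f f_monic f_0 g_nz g fg Lg LLf min by (auto simp: S_def)
  have uniq: "(\<exists>\<alpha> \<beta>. \<alpha> \<noteq> 0 \<and> f' = smult \<alpha> f + [:\<beta>:]) \<and> (\<exists>p. g' = pcompose p f * g) \<and>
                 Lf f' = Lf f \<and> Lfg f' g' \<subseteq> Lfg f g"
    if f': "degree f' \<ge> 1" and g': "g' \<noteq> 0" and sub: "Lfg f' g' \<subseteq> L" "L \<subseteq> Lf f'" for f' g'
  proof -
    \<comment> \<open>The chain L(f',g') inside L inside L(f) gives this membership, and the chain
      L(f,g) inside L inside L(f') gives the reverse one.\<close>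
    have "f' \<in> kpoly_in f"
      using Lfg_subset_Lfg_imp_in_kpoly_in[OF f g'] sub LLf unfolding Lf_def by blast
    moreover have "f \<in> kpoly_in f'"
      using Lfg_subset_Lfg_imp_in_kpoly_in[OF f' g_nz] sub Lg unfolding Lf_def by blast
    ultimately obtain \<alpha> \<beta> where ab: "\<alpha> \<noteq> 0" "f' = smult \<alpha> f + [:\<beta>:]"
      using mutual_kpoly_in_imp_affine[OF f] by blast
    have eq: "Lfg f' g' = Lfg f g'" using ab by (simp add: Lfg_affine)
    then have "g' \<in> S" using sub by (simp add: S_def)
    then have "g' \<in> Lfg f g" using S_gen by blast
    then obtain p where p: "g' = pcompose p f * g" by (auto simp: Lfg_def)
    have "Lfg f g' \<subseteq> Lfg f g"
      unfolding p by (auto simp: Lfg_image mult.assoc[symmetric] kpoly_in_mult)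
    then show ?thesis using ab p eq by (auto simp: Lf_affine)
  qed
  have norm_uniq: "f' = f \<and> g' = g" if n: "normalised_pair L f' g'" for f' g'
  proof -
    note n' = n[unfolded normalised_pair_def]
    obtain \<alpha> \<beta> p where ab: "\<alpha> \<noteq> 0" "f' = smult \<alpha> f + [:\<beta>:]" and p: "g' = pcompose p f * g"
      using uniq[of f' g'] n' by blast
    have "degree f' = degree f" using ab f by (simp add: degree_add_eq_left)
    then have "lead_coeff f' = \<alpha> * lead_coeff f"
      using f by (simp add: ab coeff_pCons split: nat.splits)
    then have "\<alpha> = 1" using n' f_monic by simp
    moreover have "\<beta> = 0" using n' f_0 ab by simp
    ultimately have ff: "f' = f" using ab by simp
    have "g' = g"
    proof (rule Lfg_monic_unique[OF f])
      show "g' \<in> Lfg f g" using p by (auto simp: Lfg_def)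
      \<comment> \<open>Once \<open>f' = f\<close>, \<open>g\<close> is itself a candidate in the
        minimality condition for \<open>g'\<close>.\<close>
      show "degree g' \<le> degree g" using n' ff g_nz fg Lg by blast
    qed (use n' g in auto)
    then show ?thesis using ff by simp
  qed
  show ?thesis
  proof (rule exI[of _ f], rule exI[of _ g], intro conjI)
    show "\<forall>f' g'. normalised_pair L f' g' \<longrightarrow> f' = f \<and> g' = g" using norm_uniq by blast
    show "\<forall>f' g'. degree f' \<ge> 1 \<longrightarrow> g' \<noteq> 0 \<longrightarrow> pderiv f' * g' \<in> kpoly_in f' \<longrightarrow>
                 Lfg f' g' \<subseteq> L \<longrightarrow> L \<subseteq> Lf f' \<longrightarrow>
                 (\<exists>\<alpha> \<beta>. \<alpha> \<noteq> 0 \<and> f' = smult \<alpha> f + [:\<beta>:]) \<and>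
                 (\<exists>p. g' = pcompose p f * g) \<and>
                 Lf f' = Lf f \<and> Lfg f' g' \<subseteq> Lfg f g"
      by (intro allI impI) (rule uniq)
  qed (fact f g_nz fg Lg LLf codim norm)+
qed

end
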